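(* Let $p$ be a prime number, let $K$ be a field that is complete with respect to an absolute value $|\cdot|$ satisfying $|p| = 1/p$, and let $R = \{a \in K : |a| \le 1\}$ be its valuation ring. Let $d$ be a positive integer and write $\mathbf{x} = (x_1,\ldots,x_d)$. Let $f \in R\langle x_1,\ldots,x_d\rangle^d$, and suppose that $f(\mathbf{x}) \equiv \mathbf{x} \pmod{p^c}$ for some real number $c > \frac{1}{p-1}$. Then there exists $g \in R\langle x_1,\ldots,x_d,n\rangle^d$ (where $n$ is one additional variable) such that, for each integer $n \in \mathbb{Z}_{\ge 0}$, the specialization of $g$ at that integer satisfies $g(\mathbf{x},n) = f^n(\mathbf{x})$ in $R\langle x_1,\ldots,x_d\rangle^d$.
   Context: For a polynomial $h$ in finitely many variables with coefficients in $R$, $\|h\|$ denotes the supremum of the absolute values of the coefficients of $h$. For variables $\mathbf{x} = (x_1,\ldots,x_d)$, the Tate algebra $R\langle \mathbf{x}\rangle = R\langle x_1,\ldots,x_d\rangle$ is the completion of $R[x_1,\ldots,x_d]$ with respect to $\|\cdot\|$. Concretely, it is the set of formal power series $h = \sum_{\mathbf{i} \in \mathbb{Z}_{\ge 0}^d} h_{\mathbf{i}} \mathbf{x}^{\mathbf{i}} \in R[[x_1,\ldots,x_d]]$ with $|h_{\mathbf{i}}| \to 0$ as $\mathbf{i} \to \infty$ (equivalently, those converging on the closed unit polydisk), and $\|h\| = \sup_{\mathbf{i}} |h_{\mathbf{i}}|$. The ring $R\langle x_1,\ldots,x_d,n\rangle$ is the Tate algebra in the $d+1$ variables $x_1,\ldots,x_d,n$.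 For $h_1,h_2 \in R\langle \mathbf{x}\rangle$ and a real number $c \ge 0$, the notation $h_1 \equiv h_2 \pmod{p^c}$ means $\|h_1-h_2\| \le |p|^c = p^{-c}$; for $h_1,h_2 \in R\langle \mathbf{x}\rangle^d$ it means that this congruence holds in each component. In $f(\mathbf{x}) \equiv \mathbf{x}$, the symbol $\mathbf{x}$ denotes the identity tuple $(x_1,\ldots,x_d) \in R\langle \mathbf{x}\rangle^d$. For $f \in R\langle \mathbf{x}\rangle^d$ and $n \in \mathbb{Z}_{\ge 0}$, $f^n$ denotes the $n$-th iterate of $f$ under composition: $f^0(\mathbf{x}) = \mathbf{x}$ and $f^{n+1}(\mathbf{x}) = f(f^n(\mathbf{x}))$, which is again an element of $R\langle \mathbf{x}\rangle^d$. *)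

theory Defs
  imports "HOL-Analysis.Analysis" "HOL-Computational_Algebra.Primes"
begin

section \<open>Fields with an absolute value\<close>

text \<open>
  Parameter \<open>absv\<close> is the absolute value (the library's \<open>norm\<close> is reserved for real vector
  spaces), and the metric is the one it induces. Completeness is expressed by adding the sort
  \<open>complete_space\<close>. The ultrametric inequality is not an axiom: as usual, it follows from
  \<open>absv (of_nat p) < 1\<close> for a prime \<open>p\<close>.
\<close>

class absolute_valued_field = field + metric_space +
  fixes absv :: "'a \<Rightarrow> real"
  assumes absv_nonneg: "0 \<le> absv x"
    and absv_eq_0_iff: "absv x = 0 \<longleftrightarrow> x = 0"
    and absv_mult: "absv (x * y) = absv x * absv y"
    and absv_triangle: "absv (x + y) \<le> absv x + absv y"
    and dist_absv: "dist x y = absv (x - y)"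

definition valuation_ring :: "'k::absolute_valued_field set" where
  "valuation_ring = {a. absv a \<le> 1}"


section \<open>Multivariate formal power series\<close>

text \<open>
  Power series in variables indexed by a type \<open>'d\<close>, the monomials being the exponent
  functions \<open>'d \<Rightarrow> nat\<close>. For finite \<open>'d\<close>, this is the ring of formal power series in
  \<open>CARD('d)\<close> variables, where \<open>CARD('d) \<ge> 1\<close>.
\<close>

typedef ('d, 'k) mfps = "UNIV :: (('d \<Rightarrow> nat) \<Rightarrow> 'k) set"
  morphisms coeff Abs_mfps ..

lemma mfps_eqI: "(\<And>i. coeff f i = coeff g i) \<Longrightarrow> f = g"
  by (metis coeff_inject ext)

lemma coeff_Abs_mfps [simp]: "coeff (Abs_mfps f) = f"
  by (simp add: Abs_mfps_inverse)

lemma finite_exponents_below: "finite {i. i \<le> k}" for k :: "'d::finite \<Rightarrow> nat"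
proof (rule finite_subset)
  show "{i. i \<le> k} \<subseteq> (\<Pi>\<^sub>E j\<in>UNIV. {..k j})"
    by (auto simp: le_fun_def)
  show "finite (\<Pi>\<^sub>E j\<in>UNIV. {..k j})"
    by (intro finite_PiE) auto
qed

instantiation mfps :: (finite, comm_ring_1) comm_ring_1
begin

definition zero_mfps_def: "0 = Abs_mfps (\<lambda>_. 0)"
definition one_mfps_def: "1 = Abs_mfps (\<lambda>i. if i = (\<lambda>_. 0) then 1 else 0)"
definition plus_mfps_def: "f + g = Abs_mfps (\<lambda>i. coeff f i + coeff g i)"
definition minus_mfps_def: "f - g = Abs_mfps (\<lambda>i. coeff f i - coeff g i)"
definition uminus_mfps_def: "- f = Abs_mfps (\<lambda>i. - coeff f i)"

text \<open>Order and subtraction of exponents are pointwise.\<close>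

definition times_mfps_def:
  "f * g = Abs_mfps (\<lambda>k. \<Sum>i\<in>{i. i \<le> k}. coeff f i * coeff g (k - i))"

instance
proof
  fix a b c :: "('a, 'b) mfps"
  show "a * b * c = a * (b * c)"
  proof (rule mfps_eqI)
    fix k :: "'a \<Rightarrow> nat"
    have diff_diff: "k - j - (i - j) = k - i" if "\<forall>x. j x \<le> i x" for i j
      using that by (simp add: fun_eq_iff)
    have "coeff (a * b * c) k =
      (\<Sum>i\<in>{i. i \<le> k}. \<Sum>j\<in>{j. j \<le> i}. coeff a j * coeff b (i - j) * coeff c (k - i))"
      by (simp add: times_mfps_def sum_distrib_right)
    also have "\<dots> = (\<Sum>(i, j)\<in>(SIGMA i:{i. i \<le> k}. {j. j \<le> i}).
        coeff a j * coeff b (i - j) * coeff c (k - i))"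
      by (intro sum.Sigma) (auto simp: finite_exponents_below)
    also have "\<dots> = (\<Sum>(j, l)\<in>(SIGMA j:{j. j \<le> k}. {l. l \<le> k - j}).
        coeff a j * (coeff b l * coeff c (k - j - l)))"
      by (rule sum.reindex_bij_witness
          [where i = "\<lambda>(j, l). (\<lambda>x. j x + l x, j)" and j = "\<lambda>(i, j). (j, i - j)"])
        (auto simp: diff_diff le_fun_def fun_eq_iff mult.assoc le_diff_conv2 add.commute
            diff_le_mono intro: le_trans)
    also have "\<dots> = (\<Sum>j\<in>{j. j \<le> k}. \<Sum>l\<in>{l. l \<le> k - j}.
        coeff a j * (coeff b l * coeff c (k - j - l)))"
      by (intro sum.Sigma[symmetric]) (auto simp: finite_exponents_below)
    also have "\<dots> = coeff (a * (b * c)) k"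
      by (simp add: times_mfps_def sum_distrib_left)
    finally show "coeff (a * b * c) k = coeff (a * (b * c)) k" .
  qed
  show "a * b = b * a"
  proof (rule mfps_eqI)
    fix k :: "'a \<Rightarrow> nat"
    show "coeff (a * b) k = coeff (b * a) k"
      unfolding times_mfps_def coeff_Abs_mfps
      by (rule sum.reindex_bij_witness[where i = "\<lambda>i. k - i" and j = "\<lambda>i. k - i"])
        (auto simp: le_fun_def fun_eq_iff fun_diff_def mult.commute)
  qed
  show "1 * a = a"
  proof (rule mfps_eqI)
    fix k :: "'a \<Rightarrow> nat"
    have "coeff (1 * a) k =
      (\<Sum>i\<in>{i. i \<le> k}. if i = (\<lambda>_. 0) then coeff a (k - i) else 0)"
      unfolding times_mfps_def one_mfps_def coeff_Abs_mfps by (intro sum.cong) auto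
    also have "\<dots> = coeff a (k - (\<lambda>_. 0))"
      by (subst sum.delta[OF finite_exponents_below]) (simp add: le_fun_def)
    also have "k - (\<lambda>_. 0) = k"
      by (simp add: fun_eq_iff)
    finally show "coeff (1 * a) k = coeff a k" .
  qed
  show "(a + b) * c = a * c + b * c"
    by (rule mfps_eqI) (simp add: times_mfps_def plus_mfps_def distrib_right sum.distrib)
  show "(0 :: ('a, 'b) mfps) \<noteq> 1"
  proof
    assume "(0 :: ('a, 'b) mfps) = 1"
    then have "coeff (0 :: ('a, 'b) mfps) (\<lambda>_. 0) = coeff 1 (\<lambda>_. 0)"
      by (rule arg_cong)
    then show False
      by (simp add: zero_mfps_def one_mfps_def)
  qed
qed (auto intro!: mfps_eqI
    simp: plus_mfps_def minus_mfps_def uminus_mfps_def zero_mfps_def algebra_simps)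

end

definition var :: "'d \<Rightarrow> ('d, 'k::comm_ring_1) mfps" where
  "var j = Abs_mfps (\<lambda>i. if i = (\<lambda>l. if l = j then 1 else 0) then 1 else 0)"


section \<open>Tate algebras\<close>

definition tate_algebra :: "('d::finite, 'k::absolute_valued_field) mfps set" where
  "tate_algebra =
    {h. (\<forall>i. coeff h i \<in> valuation_ring) \<and> ((\<lambda>i. absv (coeff h i)) \<longlongrightarrow> 0) cofinite}"

text \<open>The supremum is only meaningful for series with bounded coefficients.\<close>

definition gauss_norm :: "('d::finite, 'k::absolute_valued_field) mfps \<Rightarrow> real" where
  "gauss_norm h = (SUP i. absv (coeff h i))"

definition tate_cong ::
  "nat \<Rightarrow> real \<Rightarrow> ('d::finite, 'k::absolute_valued_field) mfps \<Rightarrow> ('d, 'k) mfps \<Rightarrow> bool" where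
  "tate_cong p c h1 h2 \<longleftrightarrow> gauss_norm (h1 - h2) \<le> absv (of_nat p :: 'k) powr c"

text \<open>
  Substitution of a tuple \<open>u\<close> into \<open>h\<close>: the series \<open>\<Sum>i. h\<^sub>i * (\<Prod>j. u\<^sub>j ^ i\<^sub>j)\<close>, summed
  coefficientwise in \<open>'k\<close>. If \<open>'k\<close> is complete and ultrametric, \<open>h\<close> lies in a Tate algebra and
  so do all \<open>u\<^sub>j\<close>, then the series converges in the Gauss norm, and this is its sum.
\<close>

definition subst ::
  "('e::finite, 'k::absolute_valued_field) mfps \<Rightarrow> ('e \<Rightarrow> ('d::finite, 'k) mfps) \<Rightarrow> ('d, 'k) mfps"
  where "subst h u = Abs_mfps (\<lambda>k. \<Sum>\<^sub>\<infinity>i. coeff h i * coeff (\<Prod>j\<in>UNIV. u j ^ i j) k)"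

primrec iterate ::
  "('d::finite \<Rightarrow> ('d, 'k::absolute_valued_field) mfps) \<Rightarrow> nat \<Rightarrow> 'd \<Rightarrow> ('d, 'k) mfps" where
  "iterate f 0 = var"
| "iterate f (Suc n) = (\<lambda>j. subst (f j) (iterate f n))"

text \<open>
  The type \<open>'d option\<close> indexes the variables \<open>Some j\<close>, corresponding to the old variables
  \<open>j :: 'd\<close>, and one additional variable \<open>None\<close>. The latter is set to the constant series \<open>a\<close>.
\<close>

definition specialize ::
  "('d::finite option, 'k::absolute_valued_field) mfps \<Rightarrow> nat \<Rightarrow> ('d, 'k) mfps" where
  "specialize h a = subst h (case_option (of_nat a) var)"

end

theory Submission
  imports Defs
begin

text \<open>
  The idea is to interpolate the iterates of \<open>f\<close> by a Newton series in the exponent. Let \<open>\<Delta>\<close> be the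
  difference operator \<open>\<Delta> h = h \<circ> f - h\<close> on the Tate algebra (\<open>delta\<close>). Composition with \<open>f\<close> is
  \<open>1 + \<Delta>\<close>, so composition with the \<open>n\<close>-th iterate is
  \<open>(1 + \<Delta>) ^ n = \<Sum>m\<le>n. (n choose m) * \<Delta> ^ m\<close> (\<open>subst_iterate_eq_sum_delta\<close>). Applied to the
  coordinate \<open>x\<^sub>j\<close>, this is the \<open>j\<close>-th component of the iterate. Here \<open>n\<close> enters through the
  binomial coefficients only, and these are polynomials in \<open>n\<close>, so the candidate is
  \<open>g\<^sub>j(x, N) = \<Sum>m. (N choose m) * (\<Delta> ^ m x\<^sub>j)(x)\<close>, a \<open>newton_series\<close>.

  It remains to see that the series converges in the Tate algebra. As \<open>f\<close> is congruent to the
  identity modulo \<open>p ^ c\<close>, so is every monomial in the \<open>f\<^sub>j\<close> to the corresponding monomial in the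
  variables, and therefore \<open>\<Delta>\<close> shrinks norms by \<open>q = p ^ (-c)\<close> (\<open>delta_le\<close>). The polynomial
  \<open>N choose m\<close> is an integral polynomial divided by \<open>m!\<close>, and \<open>|m!| \<ge> p ^ (- m / (p - 1))\<close>
  (\<open>absv_fact_ge\<close>). So the \<open>m\<close>-th term has norm at most \<open>p ^ (m * (1 / (p - 1) - c))\<close>, which tends
  to \<open>0\<close> by the hypothesis on \<open>c\<close>.

  The rest is ultrametric analysis. The condition \<open>|p| < 1\<close> forces the ultrametric inequality
  (\<open>absv_of_nat_le_one\<close>, \<open>ultrametric_of_bounded_nats\<close>). In a complete ultrametric field, families
  tending to \<open>0\<close> are summable and their iterated sums can be exchanged (\<open>has_sum_exchange\<close>). From
  this it follows that substitution is a ring homomorphism of Tate algebras (\<open>subst_times\<close>), that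
  it is associative (\<open>subst_subst\<close>), and that a Newton series may be specialized term by term
  (\<open>has_sum_specialize_newton_series\<close>).
\<close>

section \<open>Absolute values and the ultrametric inequality\<close>

lemma absv_zero [simp]: "absv (0 :: 'k::absolute_valued_field) = 0"
  by (simp add: absv_eq_0_iff)

lemma absv_one [simp]: "absv (1 :: 'k::absolute_valued_field) = 1"
proof -
  have "absv (1::'k) * absv (1::'k) = absv (1::'k)"
    by (simp flip: absv_mult)
  moreover have "absv (1::'k) \<noteq> 0"
    by (simp add: absv_eq_0_iff)
  ultimately show ?thesis by simp
qed

lemma absv_power: "absv (x ^ n :: 'k::absolute_valued_field) = absv x ^ n"
  by (induction n) (simp_all add: absv_mult)

lemma absv_minus_commute: "absv (x - y :: 'k::absolute_valued_field) = absv (y - x)"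
  by (metis dist_absv dist_commute)

lemma absv_minus [simp]: "absv (- x :: 'k::absolute_valued_field) = absv x"
  using absv_minus_commute[of 0 x] by simp

lemma absv_divide: "absv (x / y :: 'k::absolute_valued_field) = absv x / absv y"
proof (cases "y = 0")
  case False
  then have "absv (x / y) * absv y = absv x"
    by (simp flip: absv_mult)
  with False show ?thesis
    by (simp add: absv_eq_0_iff field_simps)
qed simp

text \<open>
  Addition and multiplication are continuous in the metric of the absolute value; this makes the
  theory of unordered sums in topological groups and rings available over \<open>'k\<close>.
\<close>

instance absolute_valued_field \<subseteq> topological_ab_group_add
proof
  fix a b :: 'a
  show "LIM x nhds a \<times>\<^sub>F nhds b. fst x + snd x :> nhds (a + b)"
    unfolding tendsto_iff
  proof (intro allI impI)
    fix e :: real assume "e > 0"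
    then have "eventually (\<lambda>x. dist x a < e/2) (nhds a)" "eventually (\<lambda>x. dist x b < e/2) (nhds b)"
      by (auto simp: eventually_nhds_metric intro!: exI[of _ "e/2"])
    from eventually_prodI[OF this]
    show "eventually (\<lambda>x. dist (fst x + snd x) (a + b) < e) (nhds a \<times>\<^sub>F nhds b)"
    proof eventually_elim
      case (elim z)
      define x y where "x = fst z" and "y = snd z"
      with elim have *: "dist x a < e/2" "dist y b < e/2" by auto
      have "dist (x + y) (a + b) = absv ((x - a) + (y - b))"
        by (simp add: dist_absv algebra_simps)
      also have "\<dots> \<le> absv (x - a) + absv (y - b)"
        by (rule absv_triangle)
      also have "\<dots> < e" using * by (simp add: dist_absv)
      finally show ?case by (simp add: x_def y_def)
    qed
  qed
  show "(uminus \<longlongrightarrow> - a) (nhds a)"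
    unfolding tendsto_iff
  proof (intro allI impI)
    fix e :: real assume "e > 0"
    moreover have "dist (- x) (- a) = dist x a" for x
      using absv_minus_commute[of x a] by (simp add: dist_absv)
    ultimately show "eventually (\<lambda>x. dist (- x) (- a) < e) (nhds a)"
      by (auto simp: eventually_nhds_metric)
  qed
qed

instance absolute_valued_field \<subseteq> topological_semigroup_mult
proof
  fix a b :: 'a
  show "LIM x nhds a \<times>\<^sub>F nhds b. fst x * snd x :> nhds (a * b)"
    unfolding tendsto_iff
  proof (intro allI impI)
    fix e :: real assume "e > 0"
    define M where "M = absv a + absv b + 1"
    define d where "d = min 1 (e / (2 * M))"
    have M: "M > 0" "absv a \<le> M" "absv b + 1 \<le> M"
      using absv_nonneg[of a] absv_nonneg[of b] by (auto simp: M_def)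
    have d: "d > 0" "d \<le> 1" "d * M \<le> e / 2"
      using \<open>e > 0\<close> M by (auto simp: d_def min_def field_simps)
    have "eventually (\<lambda>x. dist x a < d) (nhds a)" "eventually (\<lambda>x. dist x b < d) (nhds b)"
      using d by (auto simp: eventually_nhds_metric intro!: exI[of _ d])
    from eventually_prodI[OF this]
    show "eventually (\<lambda>x. dist (fst x * snd x) (a * b) < e) (nhds a \<times>\<^sub>F nhds b)"
    proof eventually_elim
      case (elim z)
      define x y where "x = fst z" and "y = snd z"
      with elim have *: "dist x a < d" "dist y b < d" by auto
      have "absv y \<le> absv (y - b) + absv b"
        using absv_triangle[of "y - b" b] by simp
      then have y: "absv y \<le> M" using * d M by (simp add: dist_absv)
      have "dist (x * y) (a * b) = absv ((x - a) * y + a * (y - b))"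
        by (simp add: dist_absv algebra_simps)
      also have "\<dots> \<le> absv ((x - a) * y) + absv (a * (y - b))"
        by (rule absv_triangle)
      also have "\<dots> = absv (x - a) * absv y + absv a * absv (y - b)"
        by (simp add: absv_mult)
      also have "absv (x - a) * absv y \<le> absv (x - a) * M"
        by (intro mult_left_mono y absv_nonneg)
      also have "absv (x - a) * M < d * M"
        using * M by (simp add: dist_absv)
      also have "absv a * absv (y - b) \<le> M * d"
        using * M by (intro mult_mono) (auto simp: dist_absv absv_nonneg)
      finally show ?case using d by (simp add: mult.commute x_def y_def)
    qed
  qed
qed

text \<open>
  Division with remainder gives \<open>|n| \<le> |p| |n div p| + p\<close>, so by induction all natural numbers
  satisfy the one bound \<open>p / (1 - |p|)\<close>. It holds for the powers of \<open>n\<close> too, hence \<open>|n| \<le> 1\<close>.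
\<close>

lemma absv_of_nat_le_one:
  fixes p :: nat
  assumes "absv (of_nat p :: 'k::absolute_valued_field) < 1" "p > 0"
  shows "absv (of_nat n :: 'k) \<le> 1"
proof -
  let ?r = "absv (of_nat p :: 'k)"
  have triv: "absv (of_nat m :: 'k) \<le> of_nat m" for m
  proof (induction m)
    case (Suc m)
    then show ?case using absv_triangle[of 1 "of_nat m :: 'k"] by simp
  qed simp
  define B where "B = real p / (1 - ?r)"
  have B: "B \<ge> 0" "?r * B + p = B"
    using assms absv_nonneg[of "of_nat p :: 'k"] by (auto simp: B_def field_simps)
  have bounded: "absv (of_nat m :: 'k) \<le> B" for m
  proof (induction m rule: less_induct)
    case (less m)
    show ?case
    proof (cases "m = 0")
      case True
      then show ?thesis using B by simp
    next
      case False
      show ?thesis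
      proof (cases "p = 1")
        case True
        then show ?thesis using assms by simp
      next
        case p1: False
        have "(of_nat m :: 'k) = of_nat p * of_nat (m div p) + of_nat (m mod p)"
          by (metis mult_div_mod_eq of_nat_add of_nat_mult)
        then have "absv (of_nat m :: 'k) \<le> ?r * absv (of_nat (m div p) :: 'k) + absv (of_nat (m mod p) :: 'k)"
          by (metis absv_mult absv_triangle)
        also have "\<dots> \<le> ?r * B + p"
        proof (intro add_mono mult_left_mono absv_nonneg)
          show "absv (of_nat (m div p) :: 'k) \<le> B"
            using False p1 assms by (intro less) auto
          have "real (m mod p) \<le> real p"
            using assms by (simp add: less_imp_le)
          with triv[of "m mod p"] show "absv (of_nat (m mod p) :: 'k) \<le> real p"
            by linarith
        qed
        finally show ?thesis using B by simp
      qed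
    qed
  qed
  show ?thesis
  proof (rule ccontr)
    assume "\<not> ?thesis"
    then obtain k where "B < absv (of_nat n :: 'k) ^ k"
      using real_arch_pow[of "absv (of_nat n :: 'k)" B] by auto
    moreover have "absv (of_nat n :: 'k) ^ k = absv (of_nat (n ^ k) :: 'k)"
      by (simp add: absv_power)
    ultimately show False using bounded[of "n ^ k"] by simp
  qed
qed

text \<open>
  The binomial theorem gives \<open>|x + y| ^ n \<le> (n + 1) max |x| |y| ^ n\<close> for all \<open>n\<close>. If
  \<open>|x + y|\<close> were larger than the maximum, the left side would grow exponentially relative to the
  right one.
\<close>

lemma ultrametric_of_bounded_nats:
  fixes x y :: "'k::absolute_valued_field"
  assumes nats: "\<And>n. absv (of_nat n :: 'k) \<le> 1"
  shows "absv (x + y) \<le> max (absv x) (absv y)"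
proof (rule ccontr)
  define M where "M = max (absv x) (absv y)"
  have M0: "M \<ge> 0" using absv_nonneg[of x] by (simp add: M_def)
  assume "\<not> absv (x + y) \<le> max (absv x) (absv y)"
  then have less: "M < absv (x + y)" unfolding M_def by linarith
  have sum_le: "absv (sum f A) \<le> (\<Sum>i\<in>A. absv (f i))" for f :: "nat \<Rightarrow> 'k" and A
  proof (induction A rule: infinite_finite_induct)
    case (insert a A)
    then show ?case using absv_triangle[of "f a" "sum f A"] by simp
  qed simp_all
  have pow: "absv (x + y) ^ n \<le> real (n + 1) * M ^ n" for n
  proof -
    have "absv (x + y) ^ n = absv (\<Sum>k\<le>n. of_nat (n choose k) * x ^ k * y ^ (n - k))"
      by (simp flip: absv_power binomial_ring)
    also have "\<dots> \<le> (\<Sum>k\<le>n. absv (of_nat (n choose k) * x ^ k * y ^ (n - k)))"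
      by (rule sum_le)
    also have "\<dots> \<le> (\<Sum>k\<le>n. M ^ n)"
    proof (rule sum_mono)
      fix k assume "k \<in> {..n}"
      have "absv (of_nat (n choose k) * x ^ k * y ^ (n - k)) \<le> 1 * M ^ k * M ^ (n - k)"
        unfolding absv_mult absv_power using M0
        by (intro mult_mono nats power_mono) (auto simp: M_def absv_nonneg)
      then show "absv (of_nat (n choose k) * x ^ k * y ^ (n - k)) \<le> M ^ n"
        using \<open>k \<in> {..n}\<close> by (simp flip: power_add)
    qed
    finally show ?thesis by simp
  qed
  show False
  proof (cases "M = 0")
    case True
    then show False using pow[of 1] less M0 by simp
  next
    case False
    define t where "t = absv (x + y) / M - 1"
    have M: "M > 0" using False M0 by simp
    then have t: "t > 0" "absv (x + y) = (1 + t) * M"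
      using less by (auto simp: t_def field_simps)
    have lin: "(1 + t) ^ n \<le> real n + 1" for n
    proof -
      have "(1 + t) ^ n * M ^ n \<le> (real n + 1) * M ^ n"
        using pow[of n] by (simp add: t(2) power_mult_distrib add.commute)
      with M show ?thesis by simp
    qed
    \<comment> \<open>Bernoulli's inequality alone gives linear growth only; its square bounds \<open>(1 + t) ^ (2 * n)\<close>
        below by a quadratic polynomial in \<open>n\<close>.\<close>
    obtain n :: nat where n: "real n > 2 / t\<^sup>2 + 2"
      using reals_Archimedean2 by blast
    have "1 + real n * t \<le> (1 + t) ^ n"
      using t by (intro Bernoulli_inequality) simp
    then have "(1 + real n * t)\<^sup>2 \<le> ((1 + t) ^ n)\<^sup>2"
      using t by (intro power_mono) auto
    also have "\<dots> = (1 + t) ^ (2 * n)"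
      by (simp add: power_mult mult.commute)
    also have "\<dots> \<le> 2 * real n + 1"
      using lin[of "2 * n"] by simp
    finally have "(real n * t)\<^sup>2 + 2 * (real n * t) \<le> 2 * real n"
      by (simp add: power2_sum)
    moreover have n0: "real n > 0"
    proof -
      have "0 \<le> 2 / t\<^sup>2" by simp
      with n show ?thesis by linarith
    qed
    moreover from n0 t have "real n * t > 0" by simp
    ultimately have "(real n * t)\<^sup>2 < real n * 2"
      by linarith
    then have "real n * (real n * t\<^sup>2) < real n * 2"
      by (simp only: power2_eq_square mult_ac)
    then have "real n * t\<^sup>2 < 2"
      using n0 by (simp only: mult_less_cancel_left_pos)
    then have "real n < 2 / t\<^sup>2"
      using t by (simp add: field_simps)
    with n show False by simp
  qed
qed

section \<open>Sums of families tending to zero\<close>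

text \<open>
  The parameter \<open>field_type\<close> only serves to fix the type \<open>'k\<close> within the locale.
\<close>

locale nonarchimedean =
  fixes field_type :: "'k::{absolute_valued_field, complete_space} itself"
  assumes ultrametric: "absv (x + y :: 'k) \<le> max (absv x) (absv y)"
begin

lemma absv_sum_le:
  fixes a :: "'i \<Rightarrow> 'k"
  assumes "\<And>i. i \<in> A \<Longrightarrow> absv (a i) \<le> B" "0 \<le> B"
  shows "absv (sum a A) \<le> B"
  using assms
proof (induction A rule: infinite_finite_induct)
  case (insert x A)
  then show ?case using ultrametric[of "a x" "sum a A"] by force
qed simp_all

lemma absv_diff_le:
  assumes "absv x \<le> B" "absv y \<le> B"
  shows "absv (x - y :: 'k) \<le> B"
  using ultrametric[of x "- y"] assms by simp

lemma absv_has_sum_le: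
  fixes a :: "'i \<Rightarrow> 'k"
  assumes "(a has_sum s) A" "\<And>i. i \<in> A \<Longrightarrow> absv (a i) \<le> B" "0 \<le> B"
  shows "absv s \<le> B"
proof (rule field_le_epsilon)
  fix e :: real assume "e > 0"
  then obtain F where F: "finite F" "F \<subseteq> A" "dist (sum a F) s \<le> e"
    using has_sum_finite_approximation[OF assms(1)] by blast
  have "absv s \<le> absv (s - sum a F) + absv (sum a F)"
    using absv_triangle[of "s - sum a F" "sum a F"] by simp
  also have "absv (s - sum a F) \<le> e"
    using F by (simp add: dist_absv absv_minus_commute)
  also have "absv (sum a F) \<le> B"
    using F assms by (intro absv_sum_le) auto
  finally show "absv s \<le> B + e" by simp
qed

text \<open>
  Convergence to \<open>0\<close> along the cofinite filter (\<open>null_family_iff_tendsto\<close>), phrased by finiteness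
  of exceptional sets because the proofs below unite, project and compare these sets.
\<close>

definition null_family :: "('i \<Rightarrow> 'k) \<Rightarrow> bool" where
  "null_family a \<longleftrightarrow> (\<forall>e>0. finite {i. absv (a i) > e})"

lemma null_familyD: "null_family a \<Longrightarrow> e > 0 \<Longrightarrow> finite {i. absv (a i) > e}"
  by (simp add: null_family_def)

lemma null_family_iff_tendsto:
  "null_family a \<longleftrightarrow> ((\<lambda>i. absv (a i)) \<longlongrightarrow> 0) cofinite"
proof
  assume a: "null_family a"
  show "((\<lambda>i. absv (a i)) \<longlongrightarrow> 0) cofinite"
    unfolding tendsto_iff eventually_cofinite
  proof (intro allI impI)
    fix e :: real assume "e > 0"
    then show "finite {i. \<not> dist (absv (a i)) 0 < e}"
      by (intro finite_subset[OF _ null_familyD[OF a, of "e/2"]]) (auto simp: absv_nonneg)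
  qed
next
  assume a: "((\<lambda>i. absv (a i)) \<longlongrightarrow> 0) cofinite"
  show "null_family a"
    unfolding null_family_def
  proof (intro allI impI)
    fix e :: real assume "e > 0"
    with a have "finite {i. \<not> dist (absv (a i)) 0 < e}"
      by (auto simp: tendsto_iff eventually_cofinite)
    then show "finite {i. absv (a i) > e}"
      by (rule rev_finite_subset) (auto simp: absv_nonneg)
  qed
qed

lemma null_family_mono:
  assumes "null_family b" "\<And>i. absv (a i) \<le> absv (b i)"
  shows "null_family a"
  unfolding null_family_def
proof (intro allI impI)
  fix e :: real assume "e > 0"
  with assms(1) have "finite {i. absv (b i) > e}" by (rule null_familyD)
  then show "finite {i. absv (a i) > e}"
    by (rule rev_finite_subset) (use assms(2) in \<open>auto intro: less_le_trans\<close>)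
qed

lemma null_family_mult_bounded:
  assumes "null_family a" "\<And>i. absv (b i) \<le> 1"
  shows "null_family (\<lambda>i. a i * b i)"
  using assms(1)
  by (rule null_family_mono) (simp add: absv_mult assms(2) mult_left_le absv_nonneg)

lemma null_family_add:
  assumes "null_family a" "null_family b"
  shows "null_family (\<lambda>i. a i + b i)"
  unfolding null_family_def
proof (intro allI impI)
  fix e :: real assume "e > 0"
  then have "finite ({i. absv (a i) > e} \<union> {i. absv (b i) > e})"
    using assms by (simp add: null_familyD)
  then show "finite {i. absv (a i + b i) > e}"
    by (rule rev_finite_subset) (auto dest: less_le_trans[OF _ ultrametric])
qed

lemma null_family_uminus: "null_family (\<lambda>i. - a i) \<longleftrightarrow> null_family a"
  by (simp add: null_family_def)

text \<open>
  A double family is null as soon as its rows are null and tend to \<open>0\<close> uniformly.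
\<close>

lemma null_family_Pair:
  assumes rows: "\<And>e. e > 0 \<Longrightarrow> finite {i. \<exists>j. absv (F (i, j)) > e}"
    and row: "\<And>i. null_family (\<lambda>j. F (i, j))"
  shows "null_family F"
  unfolding null_family_def
proof (intro allI impI)
  fix e :: real assume e: "e > 0"
  have "finite (SIGMA i:{i. \<exists>j. absv (F (i, j)) > e}. {j. absv (F (i, j)) > e})"
    using rows[OF e] null_familyD[OF row e] by (rule finite_SigmaI)
  then show "finite {x. absv (F x) > e}"
    by (rule rev_finite_subset) auto
qed

lemma null_family_times:
  assumes "null_family a" "\<And>i. absv (a i) \<le> 1" "null_family b" "\<And>j. absv (b j) \<le> 1"
  shows "null_family (\<lambda>(i, j). a i * b j)"
proof (rule null_family_Pair)
  fix e :: real assume e: "e > 0"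
  have "absv (a i * b j) \<le> absv (a i)" for i j
    by (simp add: absv_mult assms mult_left_le absv_nonneg)
  then show "finite {i. \<exists>j. absv (case (i, j) of (i, j) \<Rightarrow> a i * b j) > e}"
    by (intro finite_subset[OF _ null_familyD[OF assms(1) e]]) (auto intro: less_le_trans)
next
  show "null_family (\<lambda>j. case (i, j) of (i, j) \<Rightarrow> a i * b j)" for i
    using null_family_mult_bounded[OF assms(3), of "\<lambda>_. a i"] assms(2) by (simp add: mult.commute)
qed

text \<open>
  By the ultrametric inequality, a finite partial sum changes by at most \<open>e\<close> when terms of absolute
  value at most \<open>e\<close> are added or removed. So the partial sums form a Cauchy net once they contain
  the finitely many larger terms, and completeness gives the limit.
\<close>

lemma null_family_summable:
  fixes a :: "'i \<Rightarrow> 'k"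
  assumes "null_family a"
  shows "a summable_on A"
proof -
  have "\<exists>P. eventually P (finite_subsets_at_top A) \<and> (\<forall>F G. P F \<and> P G \<longrightarrow> dist (sum a F) (sum a G) < e)"
    if "e > 0" for e
  proof -
    define S where "S = {i \<in> A. absv (a i) > e / 2}"
    have S: "finite S" "S \<subseteq> A"
      unfolding S_def using null_familyD[OF assms, of "e / 2"] that by auto
    define P where "P F \<longleftrightarrow> finite F \<and> S \<subseteq> F \<and> F \<subseteq> A" for F
    have "dist (sum a F) (sum a G) < e" if P: "P F" "P G" for F G
    proof -
      have near: "absv (sum a F - sum a S) \<le> e / 2" if "P F" for F
      proof -
        have "sum a F - sum a S = sum a (F - S)"
          using that by (subst sum_diff) (auto simp: P_def)
        also have "absv \<dots> \<le> e / 2"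
          using that \<open>e > 0\<close> by (intro absv_sum_le) (auto simp: P_def S_def)
        finally show ?thesis .
      qed
      have "absv ((sum a F - sum a S) - (sum a G - sum a S)) \<le> e / 2"
        by (intro absv_diff_le near P)
      then show ?thesis using \<open>e > 0\<close> by (simp add: dist_absv)
    qed
    moreover have "eventually P (finite_subsets_at_top A)"
      using S by (auto simp: P_def eventually_finite_subsets_at_top)
    ultimately show ?thesis by blast
  qed
  then have "cauchy_filter (filtermap (sum a) (finite_subsets_at_top A))"
    by (simp add: cauchy_filter_metric_filtermap)
  moreover have "complete (UNIV :: 'k set)"
    by (meson Cauchy_convergent UNIV_I complete_def convergent_def)
  ultimately obtain s where "(sum a \<longlongrightarrow> s) (finite_subsets_at_top A)"
    using complete_uniform[where S = UNIV] by (force simp add: filterlim_def)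
  then show ?thesis
    using summable_on_def has_sum_def by blast
qed

lemma null_family_has_sum: "null_family a \<Longrightarrow> (a has_sum infsum a A) A"
  by (simp add: null_family_summable)

lemma has_sum_iterated:
  assumes F: "null_family F"
    and inner: "\<And>i. ((\<lambda>j. F (i, j)) has_sum g i) UNIV"
  shows "(F has_sum infsum g UNIV) UNIV"
proof -
  have S: "(F has_sum infsum F UNIV) (Sigma UNIV (\<lambda>_. UNIV))"
    using null_family_has_sum[OF F] by simp
  from has_sum_SigmaD[OF this inner] have "infsum g UNIV = infsum F UNIV"
    by (rule infsumI)
  with null_family_has_sum[OF F] show ?thesis by simp
qed

text \<open>
  Fubini for null families: both iterated sums are equal to the sum over all pairs.
\<close>

lemma has_sum_exchange:
  assumes F: "null_family F"
    and rows: "\<And>i. ((\<lambda>j. F (i, j)) has_sum g i) UNIV"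
    and cols: "\<And>j. ((\<lambda>i. F (i, j)) has_sum h j) UNIV"
    and g: "(g has_sum s) UNIV"
  shows "(h has_sum s) UNIV"
proof -
  have "(F has_sum s) UNIV"
    using has_sum_iterated[OF F rows] infsumI[OF g] by simp
  then have "((\<lambda>(j, i). F (i, j)) has_sum s) (Sigma UNIV (\<lambda>_. UNIV))"
    using has_sum_swap[of F UNIV UNIV s] by simp
  then show ?thesis
    by (rule has_sum_SigmaD) (use cols in simp)
qed

lemma has_sum_times:
  assumes a: "null_family a" "\<And>i. absv (a i) \<le> 1" "(a has_sum s) UNIV"
    and b: "null_family b" "\<And>j. absv (b j) \<le> 1" "(b has_sum t) UNIV"
  shows "((\<lambda>(i, j). a i * b j) has_sum (s * t)) UNIV"
proof -
  have "((\<lambda>(i, j). a i * b j) has_sum infsum (\<lambda>i. a i * t) UNIV) UNIV"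
    by (rule has_sum_iterated[OF null_family_times[OF a(1,2) b(1,2)]])
      (use has_sum_cmult_right[OF b(3)] in simp)
  then show ?thesis
    using infsumI[OF has_sum_cmult_left[OF a(3)]] by simp
qed

lemma has_sum_finite_sum:
  fixes a :: "'j \<Rightarrow> 'i \<Rightarrow> 'k"
  assumes "\<And>j. j \<in> J \<Longrightarrow> (a j has_sum s j) A"
  shows "((\<lambda>i. \<Sum>j\<in>J. a j i) has_sum (\<Sum>j\<in>J. s j)) A"
  using assms by (induction J rule: infinite_finite_induct) (auto intro!: has_sum_add)

end

section \<open>Tate algebras\<close>

lemma coeff_le_gauss_norm:
  fixes h :: "('d::finite, 'k::absolute_valued_field) mfps"
  assumes "\<And>i. absv (coeff h i) \<le> B"
  shows "absv (coeff h i) \<le> gauss_norm h"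
  unfolding gauss_norm_def
  by (rule cSUP_upper[OF UNIV_I bdd_aboveI2]) (rule assms)

lemma coeff_zero [simp]: "coeff 0 k = 0"
  by (simp add: zero_mfps_def)

lemma coeff_add [simp]: "coeff (f + g) k = coeff f k + coeff g k"
  by (simp add: plus_mfps_def)

lemma coeff_diff [simp]: "coeff (f - g) k = coeff f k - coeff g k"
  by (simp add: minus_mfps_def)

lemma coeff_one: "coeff 1 k = (if k = (\<lambda>_. 0) then 1 else 0)"
  by (simp add: one_mfps_def)

lemma coeff_sum: "coeff (sum f A) k = (\<Sum>i\<in>A. coeff (f i) k)"
  by (induction A rule: infinite_finite_induct) simp_all

lemma coeff_times: "coeff (f * g) k = (\<Sum>i\<in>{i. i \<le> k}. coeff f i * coeff g (k - i))"
  by (simp add: times_mfps_def)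

lemma coeff_of_nat_times:
  "coeff (of_nat n * f) k = of_nat n * coeff f k"
  by (induction n) (simp_all add: algebra_simps)

text \<open>
  A product of powers of variables, \<open>\<Prod>j. var j ^ i j\<close>; the two are identified in
  \<open>prod_var_power\<close>.
\<close>

definition monomial :: "('d::finite \<Rightarrow> nat) \<Rightarrow> ('d, 'k::comm_ring_1) mfps" where
  "monomial i = Abs_mfps (\<lambda>k. if k = i then 1 else 0)"

lemma coeff_monomial: "coeff (monomial i) k = (if k = i then 1 else 0)"
  by (simp add: monomial_def)

lemma monomial_zero: "monomial (\<lambda>_. 0) = 1"
  by (rule mfps_eqI) (simp add: coeff_monomial one_mfps_def)

lemma var_eq_monomial: "var j = monomial (\<lambda>l. if l = j then 1 else 0)"
  by (simp add: var_def monomial_def)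

lemma monomial_times: "monomial i * monomial j = monomial (\<lambda>l. i l + j l)"
proof (rule mfps_eqI)
  fix k
  have "coeff (monomial i * monomial j) k
    = (\<Sum>a\<in>{a. a \<le> k}. if a = i then (if k - a = j then 1 else 0) else 0)"
    unfolding coeff_times by (intro sum.cong) (auto simp: coeff_monomial)
  also have "\<dots> = (if i \<le> k \<and> k - i = j then 1 else 0)"
    by (subst sum.delta[OF finite_exponents_below]) auto
  also have "(i \<le> k \<and> k - i = j) \<longleftrightarrow> k = (\<lambda>l. i l + j l)"
    by (auto simp: le_fun_def fun_eq_iff) (metis le_add_diff_inverse)
  finally show "coeff (monomial i * monomial j) k = coeff (monomial (\<lambda>l. i l + j l)) k"
    by (simp add: coeff_monomial)
qed

lemma var_power: "var j ^ n = monomial (\<lambda>l. if l = j then n else 0)"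
proof (induction n)
  case 0
  show ?case by (simp flip: monomial_zero)
next
  case (Suc n)
  then show ?case
    by (auto simp: var_eq_monomial monomial_times intro!: arg_cong[where f = monomial])
qed

lemma prod_var_power: "(\<Prod>j\<in>UNIV. var j ^ i j) = monomial i"
proof -
  have "(\<Prod>j\<in>A. var j ^ i j) = monomial (\<lambda>l. if l \<in> A then i l else 0)" if "finite A" for A
    using that
    by (induction A) (auto simp: var_power monomial_times monomial_zero
        intro!: arg_cong[where f = monomial])
  from this[of UNIV] show ?thesis by simp
qed

context nonarchimedean
begin

lemma tate_algebra_iff:
  "h \<in> tate_algebra \<longleftrightarrow> (\<forall>i. absv (coeff h i :: 'k) \<le> 1) \<and> null_family (coeff h)"
  by (simp add: tate_algebra_def valuation_ring_def null_family_iff_tendsto)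

lemma tate_algebraI:
  assumes "\<And>i. absv (coeff h i :: 'k) \<le> 1" "null_family (coeff h)"
  shows "h \<in> tate_algebra"
  using assms by (simp add: tate_algebra_iff)

lemma tate_coeff_le: "h \<in> tate_algebra \<Longrightarrow> absv (coeff h i :: 'k) \<le> 1"
  by (simp add: tate_algebra_iff)

lemma tate_null_family: "(h :: ('d::finite, 'k) mfps) \<in> tate_algebra \<Longrightarrow> null_family (coeff h)"
  by (simp add: tate_algebra_iff)

lemma monomial_in_tate: "(monomial i :: ('d::finite, 'k) mfps) \<in> tate_algebra"
proof (rule tate_algebraI)
  show "null_family (coeff (monomial i :: ('d, 'k) mfps))"
    unfolding null_family_def
    by (auto simp: coeff_monomial intro: finite_subset[of _ "{i}"])
qed (simp add: coeff_monomial)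

lemma one_in_tate: "(1 :: ('d::finite, 'k) mfps) \<in> tate_algebra"
  using monomial_in_tate[of "\<lambda>_. 0"] by (simp add: monomial_zero)

lemma var_in_tate: "(var j :: ('d::finite, 'k) mfps) \<in> tate_algebra"
  by (simp add: var_eq_monomial monomial_in_tate)

lemma diff_in_tate:
  fixes f g :: "('d::finite, 'k) mfps"
  assumes "f \<in> tate_algebra" "g \<in> tate_algebra"
  shows "f - g \<in> tate_algebra"
proof (rule tate_algebraI)
  have "null_family (\<lambda>i. coeff f i + - coeff g i)"
    using assms by (intro null_family_add) (simp_all add: null_family_uminus tate_null_family)
  then show "null_family (coeff (f - g))"
    by (rule null_family_mono) simp
qed (use assms in \<open>simp add: absv_diff_le tate_coeff_le\<close>)

lemma coeff_times_le:
  fixes f g :: "('d::finite, 'k) mfps"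
  assumes "\<And>i. absv (coeff f i) \<le> A" "\<And>i. absv (coeff g i) \<le> B"
  shows "absv (coeff (f * g) k) \<le> A * B"
proof -
  have "0 \<le> A" "0 \<le> B"
    using assms absv_nonneg order_trans by blast+
  then show ?thesis
    unfolding coeff_times
    by (intro absv_sum_le) (auto simp: absv_mult absv_nonneg assms intro!: mult_mono)
qed

text \<open>
  If a coefficient of \<open>f * g\<close> at \<open>k\<close> is larger than \<open>e\<close>, then by the ultrametric inequality so
  is \<open>coeff f i * coeff g j\<close> for some \<open>i + j = k\<close>, and there are only finitely many such pairs.
\<close>

lemma times_in_tate:
  fixes f g :: "('d::finite, 'k) mfps"
  assumes "f \<in> tate_algebra" "g \<in> tate_algebra"
  shows "f * g \<in> tate_algebra"
proof (rule tate_algebraI)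
  show "absv (coeff (f * g) i) \<le> 1" for i
    using coeff_times_le[of f 1 g 1 i] assms by (simp add: tate_coeff_le)
  show "null_family (coeff (f * g))"
    unfolding null_family_def
  proof (intro allI impI)
    fix e :: real assume e: "e > 0"
    define S where "S = {x. absv (case x of (i, j) \<Rightarrow> coeff f i * coeff g j) > e}"
    have "finite S"
      unfolding S_def
      by (rule null_familyD[OF null_family_times e]) (use assms in \<open>simp_all add: tate_algebra_iff\<close>)
    moreover have "{k. absv (coeff (f * g) k) > e} \<subseteq> (\<lambda>(i, j). (\<lambda>l. i l + j l)) ` S"
    proof (rule subsetI, rule ccontr)
      fix k assume k: "k \<in> {k. absv (coeff (f * g) k) > e}"
        and notin: "k \<notin> (\<lambda>(i, j). (\<lambda>l. i l + j l)) ` S"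
      have "(i, k - i) \<notin> S" if "i \<le> k" for i
      proof
        assume "(i, k - i) \<in> S"
        moreover have "k = (\<lambda>(i, j). (\<lambda>l. i l + j l)) (i, k - i)"
          using that by (auto simp: le_fun_def fun_eq_iff)
        ultimately show False using notin by blast
      qed
      then have "absv (coeff (f * g) k) \<le> e"
        unfolding coeff_times using e
        by (intro absv_sum_le) (auto simp: S_def not_less)
      with k show False by simp
    qed
    ultimately show "finite {k. absv (coeff (f * g) k) > e}"
      using finite_surj by blast
  qed
qed

lemma power_in_tate:
  "(f :: ('d::finite, 'k) mfps) \<in> tate_algebra \<Longrightarrow> f ^ n \<in> tate_algebra"
  by (induction n) (simp_all add: one_in_tate times_in_tate)

lemma prod_in_tate:
  fixes f :: "'j \<Rightarrow> ('d::finite, 'k) mfps"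
  shows "(\<And>j. j \<in> A \<Longrightarrow> f j \<in> tate_algebra) \<Longrightarrow> prod f A \<in> tate_algebra"
  by (induction A rule: infinite_finite_induct) (simp_all add: one_in_tate times_in_tate)

lemma prod_power_in_tate:
  fixes u :: "'e::finite \<Rightarrow> ('d::finite, 'k) mfps"
  shows "\<forall>j. u j \<in> tate_algebra \<Longrightarrow> (\<Prod>j\<in>UNIV. u j ^ i j) \<in> tate_algebra"
  by (simp add: prod_in_tate power_in_tate)

end

section \<open>Substitution in Tate algebras\<close>

context nonarchimedean
begin

lemma subst_terms_null:
  fixes h :: "('e::finite, 'k) mfps" and u :: "'e \<Rightarrow> ('d::finite, 'k) mfps"
  assumes "h \<in> tate_algebra" "\<forall>j. u j \<in> tate_algebra"
  shows "null_family (\<lambda>i. coeff h i * coeff (\<Prod>j\<in>UNIV. u j ^ i j) k)"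
  using assms
  by (intro null_family_mult_bounded) (simp_all add: tate_null_family tate_coeff_le prod_power_in_tate)

lemma has_sum_subst:
  fixes h :: "('e::finite, 'k) mfps" and u :: "'e \<Rightarrow> ('d::finite, 'k) mfps"
  assumes "h \<in> tate_algebra" "\<forall>j. u j \<in> tate_algebra"
  shows "((\<lambda>i. coeff h i * coeff (\<Prod>j\<in>UNIV. u j ^ i j) k) has_sum coeff (subst h u) k) UNIV"
  unfolding subst_def coeff_Abs_mfps
  by (rule null_family_has_sum[OF subst_terms_null]) (use assms in simp_all)

text \<open>
  Off the finitely many positions \<open>k\<close> at which one of the finitely many products with
  \<open>|coeff h i| > e\<close> has a coefficient larger than \<open>e\<close>, all terms of the sum defining the coefficient
  of \<open>subst h u\<close> are at most \<open>e\<close>.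
\<close>

lemma subst_in_tate:
  fixes h :: "('e::finite, 'k) mfps" and u :: "'e \<Rightarrow> ('d::finite, 'k) mfps"
  assumes h: "h \<in> tate_algebra" and u: "\<forall>j. u j \<in> tate_algebra"
  shows "subst h u \<in> tate_algebra"
proof (rule tate_algebraI)
  let ?M = "\<lambda>i. \<Prod>j\<in>UNIV. u j ^ i j"
  note M = prod_power_in_tate[OF u]
  show "absv (coeff (subst h u) k) \<le> 1" for k
    using h M
    by (intro absv_has_sum_le[OF has_sum_subst[OF h u]])
      (simp_all add: absv_mult mult_le_one tate_coeff_le absv_nonneg)
  show "null_family (coeff (subst h u))"
    unfolding null_family_def
  proof (intro allI impI)
    fix e :: real assume e: "e > 0"
    define S where "S = (\<Union>i\<in>{i. absv (coeff h i) > e}. {k. absv (coeff (?M i) k) > e})"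
    have "finite S"
      unfolding S_def using null_familyD[OF tate_null_family[OF h] e] null_familyD[OF tate_null_family[OF M] e]
      by blast
    have "absv (coeff (subst h u) k) \<le> e" if "k \<notin> S" for k
    proof (rule absv_has_sum_le[OF has_sum_subst[OF h u]])
      fix i
      have "absv (coeff h i) \<le> e \<or> absv (coeff (?M i) k) \<le> e"
        using that by (auto simp: S_def not_less)
      then show "absv (coeff h i * coeff (?M i) k) \<le> e"
      proof
        assume "absv (coeff h i) \<le> e"
        then have "absv (coeff h i) * absv (coeff (?M i) k) \<le> e * 1"
          using tate_coeff_le[OF M] e by (intro mult_mono absv_nonneg) auto
        then show ?thesis by (simp add: absv_mult)
      next
        assume "absv (coeff (?M i) k) \<le> e"
        then have "absv (coeff h i) * absv (coeff (?M i) k) \<le> 1 * e"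
          using tate_coeff_le[OF h] e by (intro mult_mono absv_nonneg) auto
        then show ?thesis by (simp add: absv_mult)
      qed
    qed (use e in simp)
    then have "{k. absv (coeff (subst h u) k) > e} \<subseteq> S"
      by (auto simp: not_le[symmetric])
    with \<open>finite S\<close> show "finite {k. absv (coeff (subst h u) k) > e}"
      by (rule rev_finite_subset)
  qed
qed

lemma subst_add:
  fixes f g :: "('e::finite, 'k) mfps" and u :: "'e \<Rightarrow> ('d::finite, 'k) mfps"
  assumes fg: "f \<in> tate_algebra" "g \<in> tate_algebra" and u: "\<forall>j. u j \<in> tate_algebra"
  shows "subst (f + g) u = subst f u + subst g u"
proof (rule mfps_eqI)
  fix k
  from has_sum_add[OF has_sum_subst[OF fg(1) u] has_sum_subst[OF fg(2) u], of k]
  show "coeff (subst (f + g) u) k = coeff (subst f u + subst g u) k"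
    by (simp add: subst_def infsumI algebra_simps)
qed

lemma subst_var_left:
  fixes u :: "'e::finite \<Rightarrow> ('d::finite, 'k) mfps"
  shows "subst (var j) u = u j"
proof (rule mfps_eqI)
  fix k
  let ?i = "\<lambda>l. if l = j then 1 else 0 :: nat"
  have "(\<Prod>l\<in>UNIV. u l ^ ?i l) = (\<Prod>l\<in>UNIV. if l = j then u l else 1)"
    by (intro prod.cong) auto
  then have "(\<Prod>l\<in>UNIV. u l ^ ?i l) = u j" by simp
  then have "((\<lambda>i. coeff (var j) i * coeff (\<Prod>l\<in>UNIV. u l ^ i l) k) has_sum coeff (u j) k) UNIV"
    by (intro has_sum_finite_neutralI[where B = "{?i}"]) (auto simp: var_eq_monomial coeff_monomial)
  then show "coeff (subst (var j) u) k = coeff (u j) k"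
    by (simp add: subst_def infsumI)
qed

lemma has_sum_monomials:
  fixes h :: "('d::finite, 'k) mfps"
  shows "((\<lambda>i. coeff h i * coeff (monomial i) k) has_sum coeff h k) UNIV"
  by (intro has_sum_finite_neutralI[where B = "{k}"]) (auto simp: coeff_monomial)

lemma subst_var_right:
  fixes h :: "('d::finite, 'k) mfps"
  shows "subst h var = h"
  using infsumI[OF has_sum_monomials]
  by (intro mfps_eqI) (simp add: subst_def prod_var_power)

lemma subst_one: "subst (1 :: ('e::finite, 'k) mfps) u = (1 :: ('d::finite, 'k) mfps)"
proof (rule mfps_eqI)
  fix k
  have "((\<lambda>i. coeff (1 :: ('e, 'k) mfps) i * coeff (\<Prod>l\<in>UNIV. u l ^ i l) k) has_sum coeff 1 k) UNIV"
    by (intro has_sum_finite_neutralI[where B = "{\<lambda>_. 0}"])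
      (auto simp: coeff_one)
  then show "coeff (subst (1 :: ('e, 'k) mfps) u) k = coeff 1 k"
    by (simp add: subst_def infsumI)
qed

text \<open>
  Substitution commutes with multiplication because \<open>(\<Prod>j. u j ^ a j) * (\<Prod>j. u j ^ b j)\<close> is the
  power product for the exponent \<open>a + b\<close>: the product of the two sums is a sum over pairs \<open>(a, b)\<close>,
  and collecting the pairs with \<open>a + b = i\<close> yields the Cauchy product coefficient \<open>coeff (f * g) i\<close>.
\<close>

lemma subst_times:
  fixes f g :: "('e::finite, 'k) mfps" and u :: "'e \<Rightarrow> ('d::finite, 'k) mfps"
  assumes f: "f \<in> tate_algebra" and g: "g \<in> tate_algebra" and u: "\<forall>j. u j \<in> tate_algebra"
  shows "subst (f * g) u = subst f u * subst g u"
proof (rule mfps_eqI)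
  fix k
  let ?M = "\<lambda>i. \<Prod>j\<in>UNIV. u j ^ i j"
  let ?s = "coeff (subst f u * subst g u) k"
  have M_add: "?M (\<lambda>l. a l + b l) = ?M a * ?M b" for a b
    by (simp add: power_add prod.distrib)
  note M = prod_power_in_tate[OF u]
  have "((\<lambda>x. \<Sum>l\<in>{l. l \<le> k}. case x of (a, b) \<Rightarrow>
      (coeff f a * coeff (?M a) l) * (coeff g b * coeff (?M b) (k - l))) has_sum ?s) UNIV"
    unfolding coeff_times[of "subst f u"]
  proof (intro has_sum_finite_sum has_sum_times)
    show "absv (coeff f a * coeff (?M a) l) \<le> 1" for a l
      using tate_coeff_le[OF f] tate_coeff_le[OF M] by (simp add: absv_mult mult_le_one absv_nonneg)
    show "absv (coeff g a * coeff (?M a) l) \<le> 1" for a l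
      using tate_coeff_le[OF g] tate_coeff_le[OF M] by (simp add: absv_mult mult_le_one absv_nonneg)
  qed (use f g u in \<open>simp_all add: subst_terms_null has_sum_subst\<close>)
  also have "(\<lambda>x. \<Sum>l\<in>{l. l \<le> k}. case x of (a, b) \<Rightarrow>
      (coeff f a * coeff (?M a) l) * (coeff g b * coeff (?M b) (k - l)))
    = (\<lambda>(a, b). coeff f a * coeff g b * coeff (?M (\<lambda>l. a l + b l)) k)"
    by (auto simp: M_add coeff_times sum_distrib_left mult_ac intro!: ext sum.cong)
  finally have pairs: "((\<lambda>(a, b). coeff f a * coeff g b * coeff (?M (\<lambda>l. a l + b l)) k) has_sum ?s) UNIV" .
  \<comment> \<open>Reindexing \<open>(a, b)\<close> as \<open>(a + b, a)\<close> turns the outer index into the total exponent.\<close>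
  have "((\<lambda>(i, a). coeff f a * coeff g (i - a) * coeff (?M i) k) has_sum ?s)
      (SIGMA i:UNIV. {a. a \<le> i})"
    using pairs
    by (subst has_sum_reindex_bij_witness[where j = "\<lambda>(i, a). (a, i - a)" and T = UNIV
          and i = "\<lambda>(a, b). (\<lambda>l. a l + b l, a)"
          and h = "\<lambda>(a, b). coeff f a * coeff g b * coeff (?M (\<lambda>l. a l + b l)) k" and s' = ?s])
      (auto simp: le_fun_def fun_eq_iff)
  then have "((\<lambda>i. \<Sum>a\<in>{a. a \<le> i}. coeff f a * coeff g (i - a) * coeff (?M i) k) has_sum ?s) UNIV"
    by (rule has_sum_SigmaD) (simp add: has_sum_finiteI finite_exponents_below)
  then have "((\<lambda>i. coeff (f * g) i * coeff (?M i) k) has_sum ?s) UNIV"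
    by (simp add: coeff_times sum_distrib_right)
  then show "coeff (subst (f * g) u) k = ?s"
    by (simp add: subst_def infsumI)
qed

lemma subst_power:
  fixes f :: "('e::finite, 'k) mfps" and u :: "'e \<Rightarrow> ('d::finite, 'k) mfps"
  assumes "f \<in> tate_algebra" "\<forall>j. u j \<in> tate_algebra"
  shows "subst (f ^ n) u = subst f u ^ n"
  using assms by (induction n) (simp_all add: subst_one subst_times power_in_tate)

lemma subst_prod:
  fixes f :: "'j \<Rightarrow> ('e::finite, 'k) mfps" and u :: "'e \<Rightarrow> ('d::finite, 'k) mfps"
  assumes "\<And>j. j \<in> A \<Longrightarrow> f j \<in> tate_algebra" "\<forall>j. u j \<in> tate_algebra"
  shows "subst (prod f A) u = (\<Prod>j\<in>A. subst (f j) u)"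
  using assms
  by (induction A rule: infinite_finite_induct) (simp_all add: subst_one subst_times prod_in_tate)

text \<open>
  Composition is associative. For a single power product in place of \<open>h\<close> this is multiplicativity
  of the substitution of \<open>w\<close>; expanding \<open>h\<close> requires interchanging the sum over its exponents with
  the one in the substitution of \<open>w\<close>.
\<close>

lemma subst_subst:
  fixes h :: "('e::finite, 'k) mfps" and u :: "'e \<Rightarrow> ('d::finite, 'k) mfps"
    and w :: "'d \<Rightarrow> ('c::finite, 'k) mfps"
  assumes h: "h \<in> tate_algebra" and u: "\<forall>j. u j \<in> tate_algebra" and w: "\<forall>j. w j \<in> tate_algebra"
  shows "subst (subst h u) w = subst h (\<lambda>j. subst (u j) w)"
proof (rule mfps_eqI)
  fix k
  let ?U = "\<lambda>a. \<Prod>j\<in>UNIV. u j ^ a j" and ?W = "\<lambda>i. \<Prod>j\<in>UNIV. w j ^ i j"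
  let ?F = "\<lambda>(a, i). coeff h a * (coeff (?U a) i * coeff (?W i) k)"
  note U = prod_power_in_tate[OF u] and W = prod_power_in_tate[OF w]
  have U_subst: "subst (?U a) w = (\<Prod>j\<in>UNIV. subst (u j) w ^ a j)" for a
    using u w by (simp add: subst_prod subst_power power_in_tate)
  have F_null: "null_family ?F"
  proof (rule null_family_Pair)
    fix e :: real assume e: "e > 0"
    have "absv (?F (a, i)) \<le> absv (coeff h a)" for a i
      using tate_coeff_le[OF U] tate_coeff_le[OF W]
      by (simp add: absv_mult mult_left_le mult_le_one absv_nonneg)
    then show "finite {a. \<exists>i. absv (?F (a, i)) > e}"
      by (intro finite_subset[OF _ null_familyD[OF tate_null_family[OF h] e]])
        (auto intro: less_le_trans)
  next
    show "null_family (\<lambda>i. ?F (a, i))" for a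
      using null_family_mult_bounded[OF subst_terms_null[OF U w, of a k], of "\<lambda>_. coeff h a"]
        tate_coeff_le[OF h] by (simp add: mult_ac)
  qed
  have "((\<lambda>i. coeff (subst h u) i * coeff (?W i) k) has_sum coeff (subst h (\<lambda>j. subst (u j) w)) k) UNIV"
  proof (rule has_sum_exchange[OF F_null])
    show "((\<lambda>i. ?F (a, i)) has_sum coeff h a * coeff (\<Prod>j\<in>UNIV. subst (u j) w ^ a j) k) UNIV" for a
      using has_sum_cmult_right[OF has_sum_subst[OF U w]] by (simp add: U_subst)
    show "((\<lambda>a. ?F (a, i)) has_sum coeff (subst h u) i * coeff (?W i) k) UNIV" for i
      using has_sum_cmult_left[OF has_sum_subst[OF h u]] by (simp add: mult.assoc)
    show "((\<lambda>a. coeff h a * coeff (\<Prod>j\<in>UNIV. subst (u j) w ^ a j) k) has_sum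
        coeff (subst h (\<lambda>j. subst (u j) w)) k) UNIV"
      using h u w by (intro has_sum_subst allI subst_in_tate) simp_all
  qed
  then show "coeff (subst (subst h u) w) k = coeff (subst h (\<lambda>j. subst (u j) w)) k"
    by (simp add: subst_def[of "subst h u"] infsumI)
qed

lemma iterate_in_tate:
  fixes f :: "'d::finite \<Rightarrow> ('d, 'k) mfps"
  assumes "\<forall>j. f j \<in> tate_algebra"
  shows "iterate f n j \<in> tate_algebra"
  using assms by (induction n arbitrary: j) (simp_all add: var_in_tate subst_in_tate)

end

section \<open>The difference operator of a map\<close>

lemma pascal_sum:
  fixes a :: "nat \<Rightarrow> 'r::comm_ring_1"
  shows "(\<Sum>m\<le>n. of_nat (n choose m) * a m) + (\<Sum>m\<le>n. of_nat (n choose m) * a (Suc m))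
    = (\<Sum>m\<le>Suc n. of_nat (Suc n choose m) * a m)"
proof -
  have "(\<Sum>m\<le>n. of_nat (n choose m) * a m) = (\<Sum>m\<le>Suc n. of_nat (n choose m) * a m)"
    by (simp add: binomial_eq_0)
  also have "\<dots> = a 0 + (\<Sum>m\<le>n. of_nat (n choose Suc m) * a (Suc m))"
    by (subst sum.atMost_Suc_shift) simp
  moreover have "(\<Sum>m\<le>Suc n. of_nat (Suc n choose m) * a m)
    = a 0 + (\<Sum>m\<le>n. of_nat (Suc n choose Suc m) * a (Suc m))"
    by (subst sum.atMost_Suc_shift) simp
  ultimately show ?thesis
    by (simp add: algebra_simps sum.distrib)
qed

context nonarchimedean
begin

text \<open>
  The difference operator of the map \<open>f\<close>, acting on functions.
\<close>

definition delta :: "('d::finite \<Rightarrow> ('d, 'k) mfps) \<Rightarrow> ('d, 'k) mfps \<Rightarrow> ('d, 'k) mfps" where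
  "delta f h = subst h f - h"

lemma delta_power_in_tate:
  assumes "\<forall>j. f j \<in> tate_algebra" "h \<in> tate_algebra"
  shows "(delta f ^^ m) h \<in> tate_algebra"
  using assms by (induction m) (simp_all add: delta_def diff_in_tate subst_in_tate)

text \<open>
  Congruences modulo the elements of norm at most \<open>q\<close> can be multiplied within the Tate algebra.
\<close>

lemma times_diff_le:
  fixes a b a' b' :: "('d::finite, 'k) mfps"
  assumes "a' \<in> tate_algebra" "b \<in> tate_algebra"
    and "\<And>k. absv (coeff (a - b) k) \<le> q" "\<And>k. absv (coeff (a' - b') k) \<le> q"
  shows "absv (coeff (a * a' - b * b') k) \<le> q"
proof -
  have "a * a' - b * b' = (a - b) * a' + b * (a' - b')"
    by (simp add: algebra_simps)
  moreover have "absv (coeff ((a - b) * a') k) \<le> q * 1"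
    by (intro coeff_times_le assms tate_coeff_le)
  moreover have "absv (coeff (b * (a' - b')) k) \<le> 1 * q"
    by (intro coeff_times_le assms tate_coeff_le)
  ultimately show ?thesis
    using ultrametric[of "coeff ((a - b) * a') k" "coeff (b * (a' - b')) k"] by simp
qed

lemma power_diff_le:
  fixes a b :: "('d::finite, 'k) mfps"
  assumes "a \<in> tate_algebra" "b \<in> tate_algebra" "\<And>k. absv (coeff (a - b) k) \<le> q" "0 \<le> q"
  shows "absv (coeff (a ^ n - b ^ n) k) \<le> q"
  using assms
proof (induction n arbitrary: k)
  case (Suc n)
  then show ?case by (simp add: times_diff_le power_in_tate del: coeff_diff)
qed simp

lemma prod_diff_le:
  fixes a b :: "'j \<Rightarrow> ('d::finite, 'k) mfps"
  assumes "\<And>j. a j \<in> tate_algebra" "\<And>j. b j \<in> tate_algebra"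
    "\<And>j k. absv (coeff (a j - b j) k) \<le> q" "0 \<le> q"
  shows "absv (coeff (prod a A - prod b A) k) \<le> q"
  using assms(4)
proof (induction A arbitrary: k rule: infinite_finite_induct)
  case (insert x A)
  then show ?case by (simp add: times_diff_le prod_in_tate assms del: coeff_diff)
qed simp_all

text \<open>
  As \<open>f\<close> is close to the identity, \<open>\<Prod>j. f j ^ i j\<close> is as close to the monomial with exponent
  \<open>i\<close>, for every \<open>i\<close>. Expanding \<open>h\<close> in monomials shows that \<open>delta f\<close> is a contraction by \<open>q\<close>.
\<close>

lemma delta_le:
  fixes f :: "'d::finite \<Rightarrow> ('d, 'k) mfps"
  assumes f: "\<forall>j. f j \<in> tate_algebra" and close: "\<And>j k. absv (coeff (f j - var j) k) \<le> q"
    and h: "h \<in> tate_algebra" "\<And>i. absv (coeff h i) \<le> B"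
  shows "absv (coeff (delta f h) k) \<le> B * q"
proof -
  have q: "0 \<le> q" and B: "0 \<le> B"
    using close h(2) absv_nonneg order_trans by blast+
  have mon: "absv (coeff (\<Prod>j\<in>UNIV. f j ^ i j) k - coeff (monomial i) k) \<le> q" for i
    using prod_diff_le[of "\<lambda>j. f j ^ i j" "\<lambda>j. var j ^ i j" q UNIV k] f q close
    by (simp add: power_in_tate var_in_tate power_diff_le prod_var_power[symmetric] flip: coeff_diff)
  have "((\<lambda>i. coeff h i * coeff (\<Prod>j\<in>UNIV. f j ^ i j) k + - (coeff h i * coeff (monomial i) k))
    has_sum coeff (subst h f) k + - coeff h k) UNIV"
    by (intro has_sum_add has_sum_subst h f has_sum_uminus[THEN iffD2]) (simp add: has_sum_monomials)
  then have "((\<lambda>i. coeff h i * (coeff (\<Prod>j\<in>UNIV. f j ^ i j) k - coeff (monomial i) k))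
    has_sum coeff (delta f h) k) UNIV"
    by (simp add: delta_def algebra_simps)
  then show ?thesis
    by (rule absv_has_sum_le) (use mon h B q in \<open>simp_all add: absv_mult mult_mono absv_nonneg\<close>)
qed

lemma delta_power_le:
  fixes f :: "'d::finite \<Rightarrow> ('d, 'k) mfps"
  assumes f: "\<forall>j. f j \<in> tate_algebra" and close: "\<And>j k. absv (coeff (f j - var j) k) \<le> q"
    and h: "h \<in> tate_algebra"
  shows "absv (coeff ((delta f ^^ m) h) k) \<le> q ^ m"
proof (induction m arbitrary: k)
  case 0
  show ?case using h by (simp add: tate_coeff_le)
next
  case (Suc m)
  show ?case
    using delta_le[OF f close delta_power_in_tate[OF f h] Suc.IH] by (simp add: mult.commute)
qed

text \<open>
  Newton's forward difference formula, the expansion of \<open>(1 + delta f) ^ n\<close>. In the induction step,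
  \<open>f\<close> is applied first: by associativity, \<open>subst h (iterate f (Suc n))\<close> is the substitution of
  \<open>iterate f n\<close> into \<open>subst h f = h + delta f h\<close>. Additivity of substitution splits this into two instances of
  the induction hypothesis, and Pascal's rule combines them.
\<close>

lemma subst_iterate_eq_sum_delta:
  fixes f :: "'d::finite \<Rightarrow> ('d, 'k) mfps"
  assumes f: "\<forall>j. f j \<in> tate_algebra" and h: "h \<in> tate_algebra"
  shows "subst h (iterate f n) = (\<Sum>m\<le>n. of_nat (n choose m) * (delta f ^^ m) h)"
  using h
proof (induction n arbitrary: h)
  case 0
  show ?case by (simp add: subst_var_right)
next
  case (Suc n)
  have it: "\<forall>j. iterate f n j \<in> tate_algebra"
    using f by (simp add: iterate_in_tate)
  have dh: "delta f h \<in> tate_algebra"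
    using delta_power_in_tate[OF f Suc.prems, of 1] by simp
  have "subst h (iterate f (Suc n)) = subst (h + delta f h) (iterate f n)"
    using subst_subst[OF Suc.prems f it] by (simp add: delta_def)
  also have "\<dots> = subst h (iterate f n) + subst (delta f h) (iterate f n)"
    by (rule subst_add[OF Suc.prems dh it])
  also have "\<dots> = (\<Sum>m\<le>n. of_nat (n choose m) * (delta f ^^ m) h)
      + (\<Sum>m\<le>n. of_nat (n choose m) * (delta f ^^ Suc m) h)"
    unfolding Suc.IH[OF Suc.prems] Suc.IH[OF dh] by (simp add: funpow_swap1)
  also have "\<dots> = (\<Sum>m\<le>Suc n. of_nat (Suc n choose m) * (delta f ^^ m) h)"
    by (rule pascal_sum)
  finally show ?case .
qed

end

section \<open>Newton series\<close>

lemma finite_power_gt: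
  fixes r e :: real
  assumes "0 \<le> r" "r < 1" "e > 0"
  shows "finite {m. r ^ m > e}"
proof -
  obtain N where N: "r ^ N < e"
    using real_arch_pow_inv assms by blast
  have "{m. r ^ m > e} \<subseteq> {..<N}"
  proof
    fix m assume "m \<in> {m. r ^ m > e}"
    then have "\<not> N \<le> m"
      using power_decreasing[of N m r] N assms by force
    then show "m \<in> {..<N}" by simp
  qed
  then show ?thesis by (rule finite_subset) simp
qed

context nonarchimedean
begin

lemma prod_specialize_power:
  fixes n :: nat and e :: "'d::finite option \<Rightarrow> nat"
  shows "coeff (\<Prod>x\<in>UNIV. case_option (of_nat n) var x ^ e x :: ('d, 'k) mfps) k
    = (if (\<lambda>j. e (Some j)) = k then of_nat n ^ e None else 0)"
proof -
  have "(\<Prod>x\<in>UNIV. case_option (of_nat n) var x ^ e x :: ('d, 'k) mfps)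
    = of_nat (n ^ e None) * monomial (\<lambda>j. e (Some j))"
    by (simp add: UNIV_option_conv prod.reindex prod_var_power)
  then show ?thesis
    by (auto simp: coeff_of_nat_times coeff_monomial simp del: of_nat_power)
      simp
qed

text \<open>
  The sum \<open>\<Sum>m. D m(x) * P m(N)\<close>, where the variable \<open>N\<close> is the one indexed by \<open>None\<close>; the
  coefficient of \<open>D m(x) * P m(N)\<close> at an exponent is the product of the coefficients at the two
  parts of the exponent.
\<close>

definition newton_series ::
  "(nat \<Rightarrow> ('d::finite, 'k) mfps) \<Rightarrow> (nat \<Rightarrow> 'k poly) \<Rightarrow> ('d option, 'k) mfps" where
  "newton_series D P =
    Abs_mfps (\<lambda>e. \<Sum>\<^sub>\<infinity>m. coeff (D m) (\<lambda>j. e (Some j)) * poly.coeff (P m) (e None))"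

context
  fixes D :: "nat \<Rightarrow> ('d::finite, 'k) mfps" and P :: "nat \<Rightarrow> 'k poly" and q s :: real
  assumes D: "\<And>m. D m \<in> tate_algebra" "\<And>m k. absv (coeff (D m) k) \<le> q ^ m"
    and P: "\<And>m l. absv (poly.coeff (P m) l) \<le> s ^ m"
    and qs: "0 \<le> q" "0 < s" "q * s < 1"
begin

lemma newton_term_le: "absv (coeff (D m) k * poly.coeff (P m) l) \<le> (q * s) ^ m"
  using qs by (simp add: absv_mult power_mult_distrib mult_mono D P absv_nonneg)

lemma newton_terms_null: "null_family (\<lambda>m. coeff (D m) k * poly.coeff (P m) l)"
  unfolding null_family_def
proof (intro allI impI)
  fix e :: real assume "e > 0"
  then show "finite {m. absv (coeff (D m) k * poly.coeff (P m) l) > e}"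
    using qs newton_term_le
    by (intro finite_subset[OF _ finite_power_gt[of "q * s" e]]) (auto intro: less_le_trans)
qed

lemma has_sum_newton_series:
  "((\<lambda>m. coeff (D m) k * poly.coeff (P m) l) has_sum
    coeff (newton_series D P) (case_option l k)) UNIV"
  using null_family_has_sum[OF newton_terms_null] by (simp add: newton_series_def)

text \<open>
  The \<open>m\<close>-th summand is bounded by \<open>(q * s) ^ m\<close>, so only finitely many summands matter for a given
  \<open>e\<close>, and each of them lies in the Tate algebra up to scaling: \<open>P m\<close> is a polynomial and \<open>D m\<close> has
  coefficients tending to \<open>0\<close>.
\<close>

lemma newton_series_in_tate: "newton_series D P \<in> tate_algebra"
proof (rule tate_algebraI)
  have split: "e = case_option (e None) (\<lambda>j. e (Some j))" for e :: "'d option \<Rightarrow> nat"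
    by (auto simp: fun_eq_iff split: option.split)
  have "absv (coeff (D m) k * poly.coeff (P m) l) \<le> 1" for m k l
    using newton_term_le[of m k l] power_le_one[of "q * s" m] qs by simp
  then show "absv (coeff (newton_series D P) e) \<le> 1" for e
    by (subst split, intro absv_has_sum_le[OF has_sum_newton_series]) simp_all
  show "null_family (coeff (newton_series D P))"
    unfolding null_family_def
  proof (intro allI impI)
    fix e :: real assume e: "e > 0"
    define S where "S = (\<Union>m\<in>{m. (q * s) ^ m > e}.
      (\<lambda>(k, l). case_option l k) ` ({k. absv (coeff (D m) k) > e / s ^ m} \<times> {..degree (P m)}))"
    have "finite S"
      unfolding S_def using qs e
      by (intro finite_UN_I finite_power_gt finite_imageI finite_cartesian_product
          null_familyD[OF tate_null_family[OF D(1)]]) auto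
    have "absv (coeff (newton_series D P) (case_option l k)) \<le> e" if "case_option l k \<notin> S" for k l
    proof (rule absv_has_sum_le[OF has_sum_newton_series])
      fix m
      show "absv (coeff (D m) k * poly.coeff (P m) l) \<le> e"
      proof (rule ccontr)
        assume "\<not> ?thesis"
        then have large: "absv (coeff (D m) k * poly.coeff (P m) l) > e" by simp
        then have "(q * s) ^ m > e"
          using newton_term_le by (rule less_le_trans)
        moreover have "l \<le> degree (P m)"
          using large e by (intro le_degree) auto
        moreover have "e < absv (coeff (D m) k) * s ^ m"
          using large P by (auto simp: absv_mult intro: less_le_trans mult_left_mono absv_nonneg)
        then have "absv (coeff (D m) k) > e / s ^ m"
          using qs by (simp add: field_simps)
        ultimately show False using that by (force simp: S_def)
      qed
    qed (use e in simp)
    then have "absv (coeff (newton_series D P) x) \<le> e" if "x \<notin> S" for x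
      using that by (subst split, subst (asm) split) blast
    then have "{x. absv (coeff (newton_series D P) x) > e} \<subseteq> S"
      by (auto simp: not_le[symmetric])
    with \<open>finite S\<close> show "finite {x. absv (coeff (newton_series D P) x) > e}"
      by (rule rev_finite_subset)
  qed
qed

text \<open>
  Setting \<open>N = n\<close> may be done in each summand separately. The coefficient of the specialization is a
  sum over the exponents \<open>l\<close> of \<open>N\<close>, each term of which is itself a sum over \<open>m\<close>; exchanging the
  two sums leaves \<open>\<Sum>l. coeff (P m) l * n ^ l\<close>, that is, the value of \<open>P m\<close> at \<open>n\<close>.
\<close>

lemma has_sum_specialize_newton_series:
  assumes nat: "absv (of_nat n :: 'k) \<le> 1"
    and sum: "((\<lambda>m. coeff (D m) k * poly (P m) (of_nat n)) has_sum t) UNIV"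
  shows "coeff (specialize (newton_series D P) n) k = t"
proof -
  let ?G = "newton_series D P"
  let ?F = "\<lambda>(m, l). coeff (D m) k * poly.coeff (P m) l * of_nat n ^ l"
  let ?h = "\<lambda>e. coeff ?G e * (if (\<lambda>j. e (Some j)) = k then of_nat n ^ e None else 0)"
  have pow: "absv ((of_nat n :: 'k) ^ l) \<le> 1" for l
    using nat by (simp add: absv_power power_le_one absv_nonneg)
  have "null_family ?F"
  proof (rule null_family_Pair)
    fix e :: real assume e: "e > 0"
    have "absv (?F (m, l)) \<le> (q * s) ^ m" for m l
      using newton_term_le[of m k l] pow[of l]
      using mult_left_le[OF pow[of l] absv_nonneg[of "coeff (D m) k * poly.coeff (P m) l"]]
      by (simp add: absv_mult)
    then show "finite {m. \<exists>l. absv (?F (m, l)) > e}"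
      using qs e by (intro finite_subset[OF _ finite_power_gt[of "q * s" e]]) (auto intro: less_le_trans)
  next
    fix m
    show "null_family (\<lambda>l. ?F (m, l))"
      unfolding null_family_def
    proof (intro allI impI)
      fix e :: real assume "e > 0"
      then have "\<not> absv (?F (m, l)) > e" if "degree (P m) < l" for l
        using that by (simp add: coeff_eq_0)
      then have "{l. absv (?F (m, l)) > e} \<subseteq> {..degree (P m)}"
        by (auto simp: not_less[symmetric])
      then show "finite {l. absv (?F (m, l)) > e}"
        by (rule finite_subset) simp
    qed
  qed
  then have "((\<lambda>l. coeff ?G (case_option l k) * of_nat n ^ l) has_sum t) UNIV"
  proof (rule has_sum_exchange)
    show "((\<lambda>l. ?F (m, l)) has_sum coeff (D m) k * poly (P m) (of_nat n)) UNIV" for m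
      by (intro has_sum_finite_neutralI[where B = "{..degree (P m)}"])
        (auto simp: poly_altdef sum_distrib_left mult.assoc coeff_eq_0)
    show "((\<lambda>m. ?F (m, l)) has_sum coeff ?G (case_option l k) * of_nat n ^ l) UNIV" for l
      using has_sum_cmult_left[OF has_sum_newton_series] by simp
  qed (rule sum)
  then have "(?h has_sum t) (range (\<lambda>l. case_option l k))"
    by (subst has_sum_reindex) (auto simp: o_def inj_on_def fun_eq_iff split: option.splits)
  moreover have "e \<in> range (\<lambda>l. case_option l k)" if "(\<lambda>j. e (Some j)) = k" for e
    using that by (intro image_eqI[of _ _ "e None"]) (auto simp: fun_eq_iff split: option.split)
  ultimately have "(?h has_sum t) UNIV"
    by (subst has_sum_cong_neutral[where T = "range (\<lambda>l. case_option l k)" and g = ?h]) auto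
  then show ?thesis
    by (simp add: specialize_def subst_def prod_specialize_power infsumI)
qed

end

end

section \<open>Binomial polynomials and the size of factorials\<close>

context nonarchimedean
begin

definition falling_factorial_poly :: "nat \<Rightarrow> 'k poly" where
  "falling_factorial_poly m = (\<Prod>i<m. [:- of_nat i, 1:])"

definition binomial_poly :: "nat \<Rightarrow> 'k poly" where
  "binomial_poly m = smult (1 / of_nat (fact m)) (falling_factorial_poly m)"

lemma poly_falling_factorial_poly:
  "poly (falling_factorial_poly m) (of_nat n) = of_nat (fact m * (n choose m))"
proof (induction m)
  case (Suc m)
  have "poly (falling_factorial_poly (Suc m)) (of_nat n)
    = of_nat (fact m * (n choose m)) * (of_nat n - of_nat m)"
    using Suc by (simp add: falling_factorial_poly_def algebra_simps)
  also have "\<dots> = of_nat (fact m * ((n - m) * (n choose m)))"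
    by (cases "m \<le> n") (simp_all add: of_nat_diff binomial_eq_0)
  also have "(n - m) * (n choose m) = Suc m * (n choose Suc m)"
    by (simp only: binomial_absorption binomial_absorb_comp)
  finally show ?case by (simp add: algebra_simps)
qed (simp add: falling_factorial_poly_def)

lemma coeff_falling_factorial_poly_le:
  assumes nats: "\<And>n. absv (of_nat n :: 'k) \<le> 1"
  shows "absv (poly.coeff (falling_factorial_poly m) l) \<le> 1"
proof (induction m arbitrary: l)
  case 0
  show ?case by (simp add: falling_factorial_poly_def coeff_1)
next
  case (Suc m)
  let ?q = "falling_factorial_poly m"
  have "falling_factorial_poly (Suc m) = pCons 0 ?q - smult (of_nat m) ?q"
    by (simp add: falling_factorial_poly_def mult.commute)
  moreover have "absv (poly.coeff (pCons 0 ?q) l) \<le> 1"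
    using Suc by (simp add: coeff_pCons split: nat.split)
  moreover have "absv (poly.coeff (smult (of_nat m) ?q) l) \<le> 1"
    using Suc nats by (simp add: absv_mult mult_le_one absv_nonneg)
  ultimately show ?case by (simp add: absv_diff_le)
qed

text \<open>
  In a Bezout relation \<open>n * x - p * y = 1\<close> the second term is smaller than \<open>1\<close>, so by the
  ultrametric inequality the first one is not.
\<close>

lemma absv_coprime_eq_one:
  assumes p: "absv (of_nat p :: 'k) < 1" "p > 0" and "coprime n p"
  shows "absv (of_nat n :: 'k) = 1"
proof -
  note nats = absv_of_nat_le_one[OF p]
  show ?thesis
  proof (cases "n = 0")
    case True
    with assms show ?thesis by simp
  next
    case False
    then obtain x y where "n * x = p * y + gcd n p"
      using bezout_nat by blast
    with \<open>coprime n p\<close> have "n * x = p * y + 1" by simp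
    then have "(of_nat n * of_nat x :: 'k) - of_nat p * of_nat y = 1"
      by (metis add_diff_cancel_left' of_nat_1 of_nat_add of_nat_mult)
    then have "1 \<le> max (absv (of_nat n * of_nat x :: 'k)) (absv (of_nat p * of_nat y :: 'k))"
      using absv_diff_le[of "of_nat n * of_nat x :: 'k" _ "of_nat p * of_nat y"]
      by (metis absv_one max.cobounded1 max.cobounded2)
    moreover have "absv (of_nat p * of_nat y :: 'k) < 1"
      using p nats[of y] mult_left_le[of "absv (of_nat y :: 'k)" "absv (of_nat p :: 'k)"]
      by (simp add: absv_mult absv_nonneg)
    ultimately have "1 \<le> absv (of_nat n * of_nat x :: 'k)" by simp
    also have "\<dots> \<le> absv (of_nat n :: 'k)"
      using nats[of x] by (simp add: absv_mult mult_left_le absv_nonneg)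
    finally show ?thesis using nats[of n] by simp
  qed
qed

context
  fixes p :: nat
  assumes prime: "prime p" and absv_p: "absv (of_nat p :: 'k) = 1 / real p"
begin

lemma absv_p_less_one: "absv (of_nat p :: 'k) < 1"
  using absv_p prime_gt_1_nat[OF prime] by simp

lemma absv_fact_add:
  assumes "r < p"
  shows "absv (of_nat (fact (p * n + r)) :: 'k) = absv (of_nat (fact (p * n)) :: 'k)"
  using assms
proof (induction r)
  case (Suc r)
  have "\<not> p dvd Suc (p * n + r)"
  proof
    assume "p dvd Suc (p * n + r)"
    then have "p dvd Suc r" using dvd_add_right_iff[of p "p * n" "Suc r"] by simp
    with Suc.prems show False by (auto dest: dvd_imp_le)
  qed
  then have "coprime (Suc (p * n + r)) p"
    using prime by (simp add: prime_imp_coprime coprime_commute)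
  then have "absv (of_nat (Suc (p * n + r)) :: 'k) = 1"
    using absv_p_less_one prime_gt_0_nat[OF prime] by (intro absv_coprime_eq_one) simp_all
  moreover have "fact (p * n + Suc r) = Suc (p * n + r) * fact (p * n + r)"
    by simp
  ultimately have "absv (of_nat (fact (p * n + Suc r)) :: 'k) = absv (of_nat (fact (p * n + r)) :: 'k)"
    by (simp only: of_nat_mult absv_mult mult_1)
  with Suc show ?case by simp
qed simp

text \<open>
  Among the factors \<open>1, \<dots>, p * n\<close> of the factorial, only the multiples \<open>p, 2 * p, \<dots>, n * p\<close> are not units.
\<close>

lemma absv_fact_mult: "absv (of_nat (fact (p * n)) :: 'k) = (1 / real p) ^ n * absv (of_nat (fact n) :: 'k)"
proof (induction n)
  case (Suc n)
  have p: "p > 0" using prime by (rule prime_gt_0_nat)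
  then have "p * Suc n = Suc (p * n + (p - 1))" by simp
  then have "fact (p * Suc n) = p * Suc n * fact (p * n + (p - 1))"
    by (metis fact_Suc of_nat_id)
  then have "absv (of_nat (fact (p * Suc n)) :: 'k)
    = absv (of_nat p :: 'k) * absv (of_nat (Suc n) :: 'k) * absv (of_nat (fact (p * n)) :: 'k)"
    using absv_fact_add[of "p - 1" n] p by (simp only: of_nat_mult absv_mult)
  moreover have "absv (of_nat (fact (Suc n)) :: 'k) = absv (of_nat (Suc n) :: 'k) * absv (of_nat (fact n) :: 'k)"
    by (simp only: fact_Suc of_nat_id of_nat_mult absv_mult)
  ultimately show ?case
    using Suc by (simp add: absv_p del: of_nat_Suc fact_Suc mult_Suc_right)
qed simp

text \<open>
  With \<open>t = p powr (- 1 / (p - 1))\<close> this says that the \<open>p\<close>-adic valuation of \<open>m!\<close> is at most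
  \<open>m / (p - 1)\<close>, which Legendre's formula sharpens. For \<open>m = p * n + r\<close> with \<open>r < p\<close>, the claim for
  \<open>n\<close> implies the one for \<open>m\<close>, as \<open>|m!| = |n!| / p ^ n\<close> and \<open>t ^ (p * n) = t ^ n / p ^ n\<close>.
\<close>

lemma absv_fact_ge:
  assumes t: "0 \<le> t" "t \<le> 1" "t ^ (p - 1) = 1 / real p"
  shows "t ^ m \<le> absv (of_nat (fact m) :: 'k)"
proof (induction m rule: less_induct)
  case (less m)
  show ?case
  proof (cases "m = 0")
    case False
    define n r where "n = m div p" and "r = m mod p"
    have p: "p > 1" using prime by (rule prime_gt_1_nat)
    have m: "m = p * n + r" "r < p" "n < m"
      using p False by (auto simp: n_def r_def)
    have "t ^ m \<le> t ^ (p * n)"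
      using t m by (intro power_decreasing) auto
    also have "p * n = (p - 1) * n + n"
      using p by (simp add: algebra_simps)
    also have "t ^ ((p - 1) * n + n) = (1 / real p) ^ n * t ^ n"
      by (simp only: power_add power_mult t)
    also have "\<dots> \<le> (1 / real p) ^ n * absv (of_nat (fact n) :: 'k)"
      using less m by (intro mult_left_mono) simp_all
    also have "\<dots> = absv (of_nat (fact m) :: 'k)"
      using m absv_fact_add[of r n] absv_fact_mult[of n] by simp
    finally show ?thesis .
  qed simp
qed

end

end

section \<open>Interpolation of the iterates\<close>

theorem theorem1:
  fixes p :: nat and c :: real
    and f :: "'d::finite \<Rightarrow> ('d, 'k::{absolute_valued_field, complete_space}) mfps"
  assumes "prime p"
    and "absv (of_nat p :: 'k) = 1 / real p"
    and "\<forall>j. f j \<in> tate_algebra"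
    and "c > 1 / (real p - 1)"
    and "\<forall>j. tate_cong p c (f j) (var j)"
  shows "\<exists>g :: 'd \<Rightarrow> ('d option, 'k) mfps.
    (\<forall>j. g j \<in> tate_algebra) \<and>
    (\<forall>n j. specialize (g j) n = iterate f n j)"
proof -
  note f = assms(3)
  have p: "p > 1" using assms(1) by (rule prime_gt_1_nat)
  have nats: "absv (of_nat n :: 'k) \<le> 1" for n
    using p assms(2) by (intro absv_of_nat_le_one[of p]) simp_all
  interpret nonarchimedean "TYPE('k)"
    by standard (rule ultrametric_of_bounded_nats[OF nats])
  define q where "q = (1 / real p) powr c"
  \<comment> \<open>The bound \<open>t ^ m\<close> for \<open>|m!|\<close> is multiplicative in \<open>m\<close>, and \<open>q / t < 1\<close> is exactly the
      hypothesis on \<open>c\<close>.\<close>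
  define t where "t = real p powr (- (1 / (real p - 1)))"
  have t: "0 < t" "t \<le> 1"
    using p powr_mono[of "- (1 / (real p - 1))" 0 "real p"] by (simp_all add: t_def)
  have "t ^ (p - 1) = real p powr (- (1 / (real p - 1)) * real (p - 1))"
    using p by (simp add: t_def powr_powr flip: powr_realpow)
  also have "- (1 / (real p - 1)) * real (p - 1) = - 1"
    using p by (simp add: of_nat_diff)
  also have "real p powr (- 1) = 1 / real p"
    using p by (simp add: powr_minus_divide)
  finally have t_pow: "t ^ (p - 1) = 1 / real p" .
  have fact_ge: "t ^ m \<le> absv (of_nat (fact m) :: 'k)" for m
    using absv_fact_ge[OF assms(1,2)] t t_pow by simp
  have fact_nz: "(of_nat (fact m) :: 'k) \<noteq> 0" for m
    using fact_ge[of m] zero_less_power[OF t(1), of m] by (auto simp: absv_eq_0_iff[symmetric])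
  have qt: "q * (1 / t) < 1"
  proof -
    have "q = real p powr (- c)" "1 / t = real p powr (1 / (real p - 1))"
      using p by (simp_all add: q_def t_def powr_divide powr_minus_divide)
    then have "q * (1 / t) = real p powr (- c + 1 / (real p - 1))"
      by (simp only: powr_add)
    also have "\<dots> < 1"
      using p assms(4) by (simp add: powr_less_one)
    finally show ?thesis .
  qed
  have close: "absv (coeff (f j - var j) k) \<le> q" for j k
  proof -
    have "f j - var j \<in> tate_algebra"
      using f by (simp add: diff_in_tate var_in_tate)
    then have "absv (coeff (f j - var j) k) \<le> gauss_norm (f j - var j)"
      by (rule coeff_le_gauss_norm[OF tate_coeff_le])
    also have "\<dots> \<le> q"
      using assms(5) by (simp add: tate_cong_def assms(2) q_def)
    finally show ?thesis .
  qed
  define D where "D j m = (delta f ^^ m) (var j)" for j m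
  have D_in: "D j m \<in> tate_algebra" for j m
    unfolding D_def by (rule delta_power_in_tate[OF f var_in_tate])
  have D_le: "absv (coeff (D j m) k) \<le> q ^ m" for j m k
    unfolding D_def by (rule delta_power_le[OF f close var_in_tate])
  have P_le: "absv (poly.coeff (binomial_poly m) l :: 'k) \<le> (1 / t) ^ m" for m l
  proof -
    have "absv (poly.coeff (binomial_poly m) l :: 'k) \<le> 1 / absv (of_nat (fact m) :: 'k)"
      using coeff_falling_factorial_poly_le[OF nats, of m l]
      by (simp add: binomial_poly_def absv_divide divide_right_mono absv_nonneg)
    also have "\<dots> \<le> (1 / t) ^ m"
      using fact_ge[of m] t by (simp add: power_divide frac_le)
    finally show ?thesis .
  qed
  have P_nat: "poly (binomial_poly m) (of_nat n :: 'k) = of_nat (n choose m)" for m n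
    using fact_nz[of m] by (simp add: binomial_poly_def poly_falling_factorial_poly)
  have q0: "0 \<le> q" "0 < 1 / t"
    using t by (simp_all add: q_def)
  note newton = D_in D_le P_le q0 qt
  define g where "g j = newton_series (D j) binomial_poly" for j
  have "specialize (g j) n = iterate f n j" for n j
  proof (rule mfps_eqI)
    fix k
    have "iterate f n j = (\<Sum>m\<le>n. of_nat (n choose m) * D j m)"
      using subst_iterate_eq_sum_delta[OF f var_in_tate] by (simp add: subst_var_left D_def)
    then have "coeff (iterate f n j) k = (\<Sum>m\<le>n. of_nat (n choose m) * coeff (D j m) k)"
      by (simp add: coeff_sum coeff_of_nat_times)
    then have "((\<lambda>m. coeff (D j m) k * poly (binomial_poly m) (of_nat n)) has_sum
        coeff (iterate f n j) k) UNIV"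
      by (intro has_sum_finite_neutralI[where B = "{..n}"])
        (auto simp: P_nat binomial_eq_0 mult.commute)
    then show "coeff (specialize (g j) n) k = coeff (iterate f n j) k"
      unfolding g_def by (rule has_sum_specialize_newton_series[OF newton nats])
  qed
  moreover have "g j \<in> tate_algebra" for j
    unfolding g_def by (rule newton_series_in_tate[OF newton])
  ultimately show ?thesis by blast
qed

end
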